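(* Let $p>1$, let $p'$ be its conjugate exponent ($\frac1p+\frac1{p'}=1$), and let $\gamma>0$, $0<\alpha,\beta\le 1$ and $-1<\mu,\nu<p-1$. For a sequence $a=\{a_n\}_{n=1}^{\infty}$ of complex numbers, define $$\mathbf{H}^{\mu,\nu}_{\alpha,\beta,\gamma}(a)(m):=m^{\frac{1}{p}[(\alpha-1)+\alpha\mu]}\sum_{n=1}^{\infty}\frac{n^{\frac{1}{p'}[(\beta-1)-(p'-1)\beta\nu]}}{[\max\{m^{\alpha},n^{\beta}\}]^{\gamma}}\,a_n,\qquad m\ge 1.$$ Then $\mathbf{H}^{\mu,\nu}_{\alpha,\beta,\gamma}$ is bounded on $l^p$ if and only if $p(\gamma-1)-(\mu-\nu)\ge 0$.
   Context: $l^p$ is the space of complex sequences $a=\{a_n\}_{n=1}^{\infty}$ with $\|a\|_p=\left(\sum_{n=1}^{\infty}|a_n|^p\right)^{1/p}<+\infty$. An operator $T$ given by such a formula is bounded on $l^p$ if for every $a\in l^p$ the series defining $T(a)(m)$ converges for all $m\geq 1$, $T(a)=\{T(a)(m)\}_{m=1}^\infty\in l^p$, and there is a constant $C$ with $\|T(a)\|_p\le C\|a\|_p$ for all $a\in l^p$. *)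

theory Defs
  imports "HOL-Analysis.Analysis"
begin

text \<open>
  A sequence indexed by the positive integers is a function on \<^typ>\<open>nat\<close> whose value at 0 is
  ignored: every series below runs over the indices \<^term>\<open>Suc n\<close>.
\<close>

definition lp :: "real \<Rightarrow> (nat \<Rightarrow> complex) set" where
  "lp p = {a. summable (\<lambda>n. norm (a (Suc n)) powr p)}"

text \<open>Meaningful on \<^term>\<open>lp p\<close> only, since divergent series have an arbitrary value.\<close>

definition lp_norm :: "real \<Rightarrow> (nat \<Rightarrow> complex) \<Rightarrow> real" where
  "lp_norm p a = (\<Sum>n. norm (a (Suc n)) powr p) powr (1 / p)"

text \<open>
  In the three definitions below \<open>q\<close> is the conjugate exponent of \<open>p\<close>. It is a separate parameter;
  the relation between the two is a hypothesis wherever they are used.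
\<close>

definition H_summand ::
  "real \<Rightarrow> real \<Rightarrow> real \<Rightarrow> real \<Rightarrow> real \<Rightarrow> (nat \<Rightarrow> complex) \<Rightarrow> nat \<Rightarrow> nat \<Rightarrow> complex"
where
  "H_summand q \<nu> \<alpha> \<beta> \<gamma> a m n =
     complex_of_real
       (real n powr ((1 / q) * ((\<beta> - 1) - (q - 1) * \<beta> * \<nu>))
        / (max (real m powr \<alpha>) (real n powr \<beta>)) powr \<gamma>) * a n"

definition H_op ::
  "real \<Rightarrow> real \<Rightarrow> real \<Rightarrow> real \<Rightarrow> real \<Rightarrow> real \<Rightarrow> real \<Rightarrow> (nat \<Rightarrow> complex) \<Rightarrow> nat \<Rightarrow> complex"
where
  "H_op p q \<mu> \<nu> \<alpha> \<beta> \<gamma> a m =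
     complex_of_real (real m powr ((1 / p) * ((\<alpha> - 1) + \<alpha> * \<mu>)))
     * (\<Sum>n. H_summand q \<nu> \<alpha> \<beta> \<gamma> a m (Suc n))"

definition H_bounded_on_lp ::
  "real \<Rightarrow> real \<Rightarrow> real \<Rightarrow> real \<Rightarrow> real \<Rightarrow> real \<Rightarrow> real \<Rightarrow> bool"
where
  "H_bounded_on_lp p q \<mu> \<nu> \<alpha> \<beta> \<gamma> \<longleftrightarrow>
     (\<forall>a\<in>lp p. (\<forall>m\<ge>1. summable (\<lambda>n. H_summand q \<nu> \<alpha> \<beta> \<gamma> a m (Suc n)))
               \<and> H_op p q \<mu> \<nu> \<alpha> \<beta> \<gamma> a \<in> lp p)
     \<and> (\<exists>C. \<forall>a\<in>lp p. lp_norm p (H_op p q \<mu> \<nu> \<alpha> \<beta> \<gamma> a) \<le> C * lp_norm p a)"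

end

theory Submission
  imports Defs
begin

text \<open>
  The condition reads \<open>\<gamma> \<ge> \<kappa>\<close> with \<open>\<kappa> = 1 + (\<mu> - \<nu>) / p\<close>, the exponent for which the kernel is
  homogeneous of degree \<open>-1\<close> in \<open>x = m powr \<alpha>\<close>, \<open>y = n powr \<beta>\<close>, up to the Jacobian factors
  of these substitutions. Since the maximum is at least 1, any larger \<open>\<gamma>\<close> only decreases the kernel,
  and the Schur test with weights \<open>n powr (-1 / (p q))\<close> applies: \<open>-1 < \<mu>, \<nu> < p - 1\<close> is what makes the
  row and column sums converge on both sides of \<open>x = y\<close>. If \<open>\<gamma> < \<kappa>\<close>, take
  \<open>a n = n powr (-1 / p)\<close> on a dyadic block where \<open>y\<close> is of size \<open>R\<close>; the values of the image on a
  dyadic block where \<open>x\<close> is of size \<open>R\<close> already contribute a constant times \<open>R powr (\<kappa> - \<gamma>)\<close> to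
  its norm, while \<open>a\<close> has norm at most 1.
\<close>

section \<open>Discrete inequalities\<close>

text \<open>After division by the two norms, Young's inequality applied termwise sums to
  \<open>1/p + 1/q = 1\<close>. A vanishing norm forces all its terms to vanish, so those cases are
  split off before dividing.\<close>

lemma Holder_sum:
  fixes x y :: "'i \<Rightarrow> real"
  assumes "p > 1" "q > 1" "1 / p + 1 / q = 1" and fin: "finite S"
    and x: "\<And>i. i \<in> S \<Longrightarrow> 0 \<le> x i" and y: "\<And>i. i \<in> S \<Longrightarrow> 0 \<le> y i"
  shows "(\<Sum>i\<in>S. x i * y i) \<le> (\<Sum>i\<in>S. x i powr p) powr (1/p) * (\<Sum>i\<in>S. y i powr q) powr (1/q)"
proof -
  define A where "A = (\<Sum>i\<in>S. x i powr p)"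
  define B where "B = (\<Sum>i\<in>S. y i powr q)"
  have "A \<ge> 0" "B \<ge> 0" unfolding A_def B_def by (simp_all add: sum_nonneg)
  then consider "A = 0" | "B = 0" | "A > 0" "B > 0" by linarith
  then show ?thesis
  proof cases
    case 1
    then have "\<forall>i\<in>S. x i powr p = 0"
      unfolding A_def using fin by (subst (asm) sum_nonneg_eq_0_iff) auto
    then have "(\<Sum>i\<in>S. x i * y i) = 0" by (intro sum.neutral) auto
    then show ?thesis by simp
  next
    case 2
    then have "\<forall>i\<in>S. y i powr q = 0"
      unfolding B_def using fin by (subst (asm) sum_nonneg_eq_0_iff) auto
    then have "(\<Sum>i\<in>S. x i * y i) = 0" by (intro sum.neutral) auto
    then show ?thesis by simp
  next
    case 3
    define a where "a = A powr (1/p)"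
    define b where "b = B powr (1/q)"
    have ab: "a > 0" "b > 0" "a powr p = A" "b powr q = B"
      using 3 assms(1,2) by (auto simp: a_def b_def powr_powr)
    have "(\<Sum>i\<in>S. (x i / a) * (y i / b)) \<le> (\<Sum>i\<in>S. x i powr p / A / p + y i powr q / B / q)"
    proof (rule sum_mono)
      fix i assume i: "i \<in> S"
      have "(x i / a) * (y i / b) \<le> (x i / a) powr p / p + (y i / b) powr q / q"
        using assms(1-3) ab x[OF i] y[OF i] by (intro Youngs_inequality) auto
      then show "(x i / a) * (y i / b) \<le> x i powr p / A / p + y i powr q / B / q"
        using ab x[OF i] y[OF i] by (simp add: powr_divide)
    qed
    also have "\<dots> = A / A / p + B / B / q"
      by (simp add: sum.distrib A_def B_def flip: sum_divide_distrib)
    also have "\<dots> = 1" using 3 assms(3) by simp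
    finally have "(\<Sum>i\<in>S. x i * y i) / (a * b) \<le> 1"
      by (simp add: sum_divide_distrib)
    then have "(\<Sum>i\<in>S. x i * y i) \<le> a * b" using ab by simp
    then show ?thesis by (simp add: a_def b_def A_def B_def)
  qed
qed

text \<open>Write \<open>K * a\<close> as \<open>(K powr (1/p) * a / f) * (K powr (1/q) * f)\<close>
  and apply Hoelder in \<open>n\<close>: the row bound absorbs the second factor, and after
  exchanging the sums the column bound absorbs the weights left by the first. All estimates are made
  on finite truncations, so that convergence comes out as a conclusion.\<close>

lemma schur_test:
  fixes K :: "nat \<Rightarrow> nat \<Rightarrow> real" and f g :: "nat \<Rightarrow> real"
  assumes p: "p > 1" and q: "q > 1" and pq: "1 / p + 1 / q = 1"
    and K: "\<And>m n. 0 \<le> K m n" and f: "\<And>n. 0 < f n" and g: "\<And>m. 0 < g m"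
    and rows: "\<And>m N. (\<Sum>n<N. K m n * f n powr q) \<le> C * g m powr q"
    and cols: "\<And>n M. (\<Sum>m<M. K m n * g m powr p) \<le> D * f n powr p"
    and a: "\<And>n. 0 \<le> a n" and sa: "summable (\<lambda>n. a n powr p)"
  shows "\<And>m. summable (\<lambda>n. K m n * a n)"
    and "summable (\<lambda>m. (\<Sum>n. K m n * a n) powr p)"
    and "(\<Sum>m. (\<Sum>n. K m n * a n) powr p) \<le> C powr (p/q) * D * (\<Sum>n. a n powr p)"
proof -
  define B where "B = C powr (p/q) * D * (\<Sum>n. a n powr p)"
  \<comment> \<open>Instantiating the row and column bounds with empty sums yields the signs of
    \<open>C\<close> and \<open>D\<close>.\<close>
  have C0: "C \<ge> 0"
  proof -
    have "0 \<le> C * g 0 powr q" using rows[of 0 0] by simp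
    then show ?thesis using g[of 0] by (simp add: zero_le_mult_iff)
  qed
  have D0: "D \<ge> 0"
  proof -
    have "0 \<le> D * f 0 powr p" using cols[of 0 0] by simp
    then show ?thesis using f[of 0] by (simp add: zero_le_mult_iff)
  qed
  have nn: "0 \<le> (\<Sum>n<N. K m n * a n)" for m N
    using K a by (intro sum_nonneg) auto
  have row: "(\<Sum>n<N. K m n * a n) powr p
      \<le> C powr (p/q) * (\<Sum>n<N. K m n * g m powr p * (a n powr p / f n powr p))" for m N
  proof -
    have "(\<Sum>n<N. K m n * a n)
        = (\<Sum>n<N. (K m n powr (1/p) * (a n / f n)) * (K m n powr (1/q) * f n))"
    proof (rule sum.cong[OF refl])
      fix n
      have "K m n = K m n powr (1/p + 1/q)" using K[of m n] by (simp only: pq powr_one)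
      also have "\<dots> = K m n powr (1/p) * K m n powr (1/q)" by (rule powr_add)
      finally show "K m n * a n
          = (K m n powr (1/p) * (a n / f n)) * (K m n powr (1/q) * f n)"
        using f[of n] by (simp add: field_simps)
    qed
    also have "\<dots> \<le> (\<Sum>n<N. (K m n powr (1/p) * (a n / f n)) powr p) powr (1/p)
        * (\<Sum>n<N. (K m n powr (1/q) * f n) powr q) powr (1/q)"
      using K a f by (intro Holder_sum p q pq) (auto simp: less_imp_le)
    also have "(\<Sum>n<N. (K m n powr (1/p) * (a n / f n)) powr p)
        = (\<Sum>n<N. K m n * (a n powr p / f n powr p))"
      using K a f p by (intro sum.cong refl)
        (simp add: powr_mult powr_divide powr_powr less_imp_le)
    also have "(\<Sum>n<N. (K m n powr (1/q) * f n) powr q) = (\<Sum>n<N. K m n * f n powr q)"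
      using K f q by (intro sum.cong refl)
        (simp add: powr_mult powr_powr less_imp_le)
    finally have "(\<Sum>n<N. K m n * a n) powr p
      \<le> ((\<Sum>n<N. K m n * (a n powr p / f n powr p)) powr (1/p)
         * (\<Sum>n<N. K m n * f n powr q) powr (1/q)) powr p"
      using nn p by (intro powr_mono2) auto
    also have "\<dots> = (\<Sum>n<N. K m n * (a n powr p / f n powr p))
        * (\<Sum>n<N. K m n * f n powr q) powr (p/q)"
    proof -
      have "0 \<le> (\<Sum>n<N. K m n * (a n powr p / f n powr p))"
        using K by (intro sum_nonneg) auto
      then show ?thesis using p by (simp add: powr_mult powr_powr)
    qed
    \<comment> \<open>The exponent \<open>p/q\<close> turns \<open>g m powr q\<close> into
      \<open>g m powr p\<close>, which is the weight that the column bound expects.\<close>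
    also have "\<dots> \<le> (\<Sum>n<N. K m n * (a n powr p / f n powr p)) * (C * g m powr q) powr (p/q)"
      using p q K by (intro mult_left_mono powr_mono2 rows sum_nonneg) auto
    also have "(C * g m powr q) powr (p/q) = C powr (p/q) * g m powr p"
      using C0 q by (simp add: powr_mult powr_powr)
    finally show ?thesis by (simp add: sum_distrib_left sum_distrib_right mult_ac)
  qed
  have fin: "(\<Sum>m<M. (\<Sum>n<N. K m n * a n) powr p) \<le> B" for M N
  proof -
    have "(\<Sum>m<M. (\<Sum>n<N. K m n * a n) powr p)
        \<le> (\<Sum>m<M. C powr (p/q) * (\<Sum>n<N. K m n * g m powr p * (a n powr p / f n powr p)))"
      by (intro sum_mono row)
    also have "\<dots> = C powr (p/q) * (\<Sum>m<M. \<Sum>n<N. K m n * g m powr p * (a n powr p / f n powr p))"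
      by (simp add: sum_distrib_left)
    also have "(\<Sum>m<M. \<Sum>n<N. K m n * g m powr p * (a n powr p / f n powr p))
        = (\<Sum>n<N. (\<Sum>m<M. K m n * g m powr p) * (a n powr p / f n powr p))"
      by (subst sum.swap) (simp only: sum_distrib_right)
    also have "C powr (p/q) * \<dots> \<le> C powr (p/q) * (\<Sum>n<N. (D * f n powr p) * (a n powr p / f n powr p))"
      by (intro mult_left_mono sum_mono mult_right_mono cols) auto
    also have "(\<Sum>n<N. (D * f n powr p) * (a n powr p / f n powr p)) = D * (\<Sum>n<N. a n powr p)"
      unfolding sum_distrib_left using f by (intro sum.cong refl) (simp add: less_imp_neq[THEN not_sym])
    also have "C powr (p/q) * (D * (\<Sum>n<N. a n powr p)) \<le> C powr (p/q) * (D * (\<Sum>n. a n powr p))"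
      using D0 sa by (intro mult_left_mono sum_le_suminf) auto
    finally show ?thesis by (simp add: B_def mult_ac)
  qed
  show sK: "summable (\<lambda>n. K m n * a n)" for m
  proof (rule bounded_imp_summable)
    show "0 \<le> K m n * a n" for n using K a by simp
    fix N
    \<comment> \<open>A single row is one term of the double truncation, so its partial sums inherit
      a bound independent of \<open>N\<close>.\<close>
    have "(\<Sum>n<Suc N. K m n * a n) powr p \<le> (\<Sum>m<Suc m. (\<Sum>n<Suc N. K m n * a n) powr p)"
      by (rule member_le_sum) auto
    then have "(\<Sum>n<Suc N. K m n * a n) powr p \<le> B" using fin[of "Suc N" "Suc m"] by linarith
    then have "((\<Sum>n<Suc N. K m n * a n) powr p) powr (1/p) \<le> B powr (1/p)"
      using p by (intro powr_mono2) auto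
    then show "(\<Sum>n\<le>N. K m n * a n) \<le> B powr (1/p)"
      using nn[of m "Suc N"] p by (simp add: powr_powr lessThan_Suc_atMost)
  qed
  \<comment> \<open>First \<open>N\<close> tends to infinity with \<open>M\<close> fixed, so the
    limit passes through a finite outer sum; only then is \<open>M\<close> released.\<close>
  have lim: "(\<Sum>m<M. (\<Sum>n. K m n * a n) powr p) \<le> B" for M
  proof (rule LIMSEQ_le_const2)
    show "(\<lambda>N. \<Sum>m<M. (\<Sum>n<N. K m n * a n) powr p)
        \<longlonglongrightarrow> (\<Sum>m<M. (\<Sum>n. K m n * a n) powr p)"
      using p nn by (intro tendsto_sum tendsto_powr' tendsto_const summable_LIMSEQ sK) auto
    show "\<exists>N. \<forall>n\<ge>N. (\<Sum>m<M. (\<Sum>n<n. K m n * a n) powr p) \<le> B"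
      using fin by blast
  qed
  show s: "summable (\<lambda>m. (\<Sum>n. K m n * a n) powr p)"
    by (rule bounded_imp_summable[of _ B]) (simp_all only: lim powr_ge_zero flip: lessThan_Suc_atMost)
  show "(\<Sum>m. (\<Sum>n. K m n * a n) powr p) \<le> C powr (p/q) * D * (\<Sum>n. a n powr p)"
    using suminf_le_const[OF s lim] by (simp add: B_def)
qed

section \<open>Sums of powers\<close>

text \<open>This is concavity of \<open>x powr d\<close>, obtained from weighted AM-GM for
  \<open>t = n / (n + 1)\<close> and 1, then rescaled by \<open>real (Suc n) powr d\<close>. The
  left side thus becomes summable by telescoping.\<close>

lemma powr_diff_lower:
  fixes d :: real
  assumes "0 < d" "d \<le> 1"
  shows "d * real (Suc n) powr (d - 1) \<le> real (Suc n) powr d - real n powr d"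
proof (cases "n = 0")
  case False
  define t where "t = real n / real (Suc n)"
  have t: "t > 0" "real n = t * real (Suc n)" "1 - t = 1 / real (Suc n)"
    using False by (auto simp: t_def field_simps)
  have "t powr d * 1 powr (1 - d) \<le> d * t + (1 - d) * 1"
    using assms t by (intro Youngs_inequality_0) auto
  then have "t powr d \<le> 1 - d * (1 - t)" by (simp add: algebra_simps)
  then have "real (Suc n) powr d * t powr d \<le> real (Suc n) powr d * (1 - d * (1 - t))"
    by (intro mult_left_mono) auto
  moreover have "real n powr d = real (Suc n) powr d * t powr d"
    unfolding t(2) using t(1) by (simp add: powr_mult)
  moreover have "real (Suc n) powr (d - 1) = real (Suc n) powr d * (1 - t)"
    unfolding t(3) by (simp add: powr_diff)
  ultimately show ?thesis by (simp only:) (simp only: algebra_simps mult_1_right)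
qed (use assms in auto)

text \<open>The counterpart for decreasing powers, from \<open>ln t \<le> t - 1\<close> and
  \<open>1 + x \<le> exp x\<close>. Index 0 has to be excluded, because \<open>0 powr e = 0\<close>
  would make the right side negative there.\<close>

lemma powr_diff_lower_neg:
  fixes e :: real
  assumes "e < 0" "n \<ge> 1"
  shows "(- e) * real (Suc n) powr (e - 1) \<le> real n powr e - real (Suc n) powr e"
proof -
  define t where "t = real n / real (Suc n)"
  have t: "t > 0" "real n = t * real (Suc n)" "1 - t = 1 / real (Suc n)"
    using assms by (auto simp: t_def field_simps)
  have "1 + e * (t - 1) \<le> 1 + e * ln t"
    using assms t ln_le_minus_one[OF t(1)] by (auto intro: mult_left_mono_neg)
  also have "\<dots> \<le> t powr e" using t by (simp add: powr_def add.commute)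
  finally have "real (Suc n) powr e * (1 + e * (t - 1)) \<le> real (Suc n) powr e * t powr e"
    by (intro mult_left_mono) auto
  moreover have "real n powr e = real (Suc n) powr e * t powr e"
    unfolding t(2) using t(1) by (simp add: powr_mult)
  moreover have "real (Suc n) powr (e - 1) = real (Suc n) powr e * (1 - t)"
    unfolding t(3) by (simp add: powr_diff)
  ultimately show ?thesis
    by (simp only:) (simp only: algebra_simps mult_1_left mult_1_right mult_minus_left mult_minus_right)
qed

lemma sum_powr_upper:
  fixes d :: real
  assumes "0 < d" "d \<le> 1"
  shows "(\<Sum>n<N. real (Suc n) powr (d - 1)) \<le> real N powr d / d"
proof -
  have "d * (\<Sum>n<N. real (Suc n) powr (d - 1)) \<le> (\<Sum>n<N. real (Suc n) powr d - real n powr d)"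
    unfolding sum_distrib_left by (intro sum_mono powr_diff_lower assms)
  also have "\<dots> = real N powr d"
    using assms by (subst sum_lessThan_telescope) simp
  finally show ?thesis using assms by (simp add: field_simps)
qed

text \<open>The increments telescope and the term at \<open>N\<close> is dropped, so the bound is
  uniform in \<open>N\<close> and controls the whole tail.\<close>

lemma sum_powr_tail_upper:
  fixes e :: real
  assumes "e < 0" "K \<ge> 1"
  shows "(\<Sum>n\<in>{K..<N}. real (Suc n) powr (e - 1)) \<le> real K powr e / (- e)"
proof (cases "K \<le> N")
  case True
  have "(- e) * (\<Sum>n\<in>{K..<N}. real (Suc n) powr (e - 1))
      \<le> (\<Sum>n\<in>{K..<N}. real n powr e - real (Suc n) powr e)"
    unfolding sum_distrib_left using assms by (intro sum_mono powr_diff_lower_neg) auto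
  also have "\<dots> = real K powr e - real N powr e"
    using sum_Suc_diff'[OF True, of "\<lambda>n. - (real n powr e)"] by simp
  also have "\<dots> \<le> real K powr e" by simp
  finally show ?thesis using assms by (simp add: field_simps)
qed (use assms in \<open>auto simp: divide_le_0_iff\<close>)

text \<open>Replace \<gamma> by \<kappa>, since the maximum is at least 1, and split the sum near
  the crossover \<open>n powr \<beta> = x\<close>. Below it the maximum is bounded below by
  \<open>x\<close>, and \<delta> > 0 keeps the power sum of order \<open>x powr \<delta>\<close>;
  above it the maximum is bounded below by \<open>n powr \<beta>\<close>, and \<delta> < \<kappa>
  makes the tail converge. Both pieces have order
  \<open>x powr (\<delta> - \<kappa>)\<close>.\<close>

lemma sum_powr_over_max_upper:
  fixes \<beta> \<delta> \<kappa> \<gamma> :: real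
  assumes b: "0 < \<beta>" "\<beta> \<le> 1" and d: "0 < \<delta>" "\<delta> \<le> 1" "\<delta> < \<kappa>" and g: "\<kappa> \<le> \<gamma>"
  shows "\<exists>C. \<forall>x\<ge>1. \<forall>N. (\<Sum>n<N. real (Suc n) powr (\<beta> * \<delta> - 1) / max x (real (Suc n) powr \<beta>) powr \<gamma>)
            \<le> C * x powr (\<delta> - \<kappa>)"
proof -
  define e where "e = \<beta> * (\<delta> - \<kappa>)"
  have e: "e < 0" unfolding e_def using b d by (simp add: mult_less_0_iff)
  have bd: "0 < \<beta> * \<delta>" "\<beta> * \<delta> \<le> 1" using b d by (auto simp: mult_le_one)
  define C where "C = 1 / (\<beta> * \<delta>) + (1/2) powr e / (- e)"
  have "(\<Sum>n<N. real (Suc n) powr (\<beta> * \<delta> - 1) / max x (real (Suc n) powr \<beta>) powr \<gamma>)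
            \<le> C * x powr (\<delta> - \<kappa>)" if x: "x \<ge> 1" for x N
  proof -
    define t where "t n = real (Suc n) powr (\<beta> * \<delta> - 1) / max x (real (Suc n) powr \<beta>) powr \<kappa>" for n
    define X where "X = x powr (1/\<beta>)"
    define K where "K = nat \<lfloor>X\<rfloor>"
    have X: "X \<ge> 1" unfolding X_def using x b by (simp add: ge_one_powr_ge_zero)
    have "1 \<le> \<lfloor>X\<rfloor>" "real K = of_int \<lfloor>X\<rfloor>" using X unfolding K_def by auto
    \<comment> \<open>The initial sum uses \<open>K \<le> X\<close>. The tail has the negative
      exponent \<open>e\<close> and so uses \<open>K \<ge> X / 2\<close>, the source of
      \<open>(1/2) powr e\<close> in \<open>C\<close>.\<close>
    then have K: "K \<ge> 1" "real K \<le> X" "X / 2 \<le> real K"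
      unfolding K_def by linarith+
    have Xpow: "X powr (\<beta> * s) = x powr s" for s unfolding X_def using b by (simp add: powr_powr)
    have t0: "t n \<ge> 0" for n unfolding t_def by simp
    have t1: "t n \<le> real (Suc n) powr (\<beta> * \<delta> - 1) * x powr (- \<kappa>)" for n
    proof -
      have "x powr \<kappa> \<le> max x (real (Suc n) powr \<beta>) powr \<kappa>"
        using x d by (intro powr_mono2) auto
      then have "t n \<le> real (Suc n) powr (\<beta> * \<delta> - 1) / x powr \<kappa>"
        unfolding t_def using x by (intro divide_left_mono mult_pos_pos) auto
      then show ?thesis by (simp add: powr_minus_divide)
    qed
    have t2: "t n \<le> real (Suc n) powr (e - 1)" for n
    proof -
      have "real (Suc n) powr (\<beta> * \<kappa>) = (real (Suc n) powr \<beta>) powr \<kappa>" by (simp add: powr_powr)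
      also have "\<dots> \<le> max x (real (Suc n) powr \<beta>) powr \<kappa>"
        using x d by (intro powr_mono2) auto
      finally have "t n \<le> real (Suc n) powr (\<beta> * \<delta> - 1) / real (Suc n) powr (\<beta> * \<kappa>)"
        unfolding t_def by (intro divide_left_mono mult_pos_pos) auto
      also have "\<dots> = real (Suc n) powr (e - 1)"
        unfolding e_def by (simp add: powr_diff[symmetric] algebra_simps)
      finally show ?thesis .
    qed
    have "(\<Sum>n<N. real (Suc n) powr (\<beta> * \<delta> - 1) / max x (real (Suc n) powr \<beta>) powr \<gamma>) \<le> (\<Sum>n<N. t n)"
      unfolding t_def using x g
      by (intro sum_mono divide_left_mono powr_mono mult_pos_pos) (auto simp: max_def)
    \<comment> \<open>Enlarging the range covers the case \<open>N < K\<close> as well. Since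
      \<open>t1\<close> and \<open>t2\<close> hold for every \<open>n\<close>, the exact position of
      the cut is immaterial.\<close>
    also have "\<dots> \<le> (\<Sum>n\<in>{..<K} \<union> {K..<N}. t n)"
      using t0 by (intro sum_mono2) auto
    also have "\<dots> = (\<Sum>n<K. t n) + (\<Sum>n\<in>{K..<N}. t n)"
      by (intro sum.union_disjoint) auto
    also have "(\<Sum>n<K. t n) \<le> (\<Sum>n<K. real (Suc n) powr (\<beta> * \<delta> - 1)) * x powr (- \<kappa>)"
      unfolding sum_distrib_right by (intro sum_mono t1)
    also have "\<dots> \<le> (real K powr (\<beta> * \<delta>) / (\<beta> * \<delta>)) * x powr (- \<kappa>)"
      by (intro mult_right_mono sum_powr_upper bd) auto
    also have "\<dots> \<le> (X powr (\<beta> * \<delta>) / (\<beta> * \<delta>)) * x powr (- \<kappa>)"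
      using K bd by (intro mult_right_mono divide_right_mono powr_mono2) auto
    also have "\<dots> = 1 / (\<beta> * \<delta>) * x powr (\<delta> - \<kappa>)"
      by (simp add: Xpow powr_diff powr_minus_divide)
    also have "(\<Sum>n\<in>{K..<N}. t n) \<le> (\<Sum>n\<in>{K..<N}. real (Suc n) powr (e - 1))"
      by (intro sum_mono t2)
    also have "\<dots> \<le> real K powr e / (- e)" by (intro sum_powr_tail_upper e K)
    also have "\<dots> \<le> (X / 2) powr e / (- e)"
      using e K X by (intro divide_right_mono powr_mono2') auto
    also have "(X / 2) powr e = (1/2) powr e * x powr (\<delta> - \<kappa>)"
      using X Xpow[of "\<delta> - \<kappa>"] powr_mult[of "1/2" X e] by (simp add: e_def)
    finally show ?thesis by (simp add: C_def algebra_simps)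
  qed
  then show ?thesis by blast
qed

text \<open>The block consists of the \<open>N\<close> integers from \<open>N\<close> to
  \<open>2 * N - 1\<close> with \<open>N = \<lceil>Y\<rceil>\<close>; they all lie within a constant
  factor of \<open>Y\<close>, so every power sum is at least a constant times
  \<open>Y powr (s + 1)\<close>. Exponent -1 normalises the test sequence; the general lower bound
  serves both its support and the rows where the image is evaluated.\<close>

lemma dyadic_block:
  fixes Y :: real
  assumes Y: "Y \<ge> 1"
  obtains S :: "nat set" where "finite S" "0 \<notin> S" "\<And>n. n \<in> S \<Longrightarrow> Y \<le> real n \<and> real n \<le> 4 * Y"
    "(\<Sum>n\<in>S. real n powr (-1)) \<le> 1"
    "\<And>s. 4 powr (- \<bar>s\<bar>) * Y powr (s + 1) \<le> (\<Sum>n\<in>S. real n powr s)"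
proof -
  define N where "N = nat \<lceil>Y\<rceil>"
  have N: "N \<ge> 1" "Y \<le> real N" "real N \<le> 2 * Y" using Y unfolding N_def by linarith+
  define S where "S = {N..<2*N}"
  have S: "Y \<le> real n \<and> real n \<le> 4 * Y" if "n \<in> S" for n
  proof -
    have "real N \<le> real n" "real n \<le> real (2 * N)" using that by (auto simp: S_def)
    then show ?thesis using N by auto
  qed
  have cardS: "card S = N" by (simp add: S_def)
  show ?thesis
  proof
    show "finite S" "0 \<notin> S" using N by (auto simp: S_def)
    show "n \<in> S \<Longrightarrow> Y \<le> real n \<and> real n \<le> 4 * Y" for n by (rule S)
    have "(\<Sum>n\<in>S. real n powr (-1)) \<le> (\<Sum>n\<in>S. 1 / real N)"
      using N by (intro sum_mono) (auto simp: S_def powr_minus_divide field_simps)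
    also have "\<dots> = 1" using N cardS by simp
    finally show "(\<Sum>n\<in>S. real n powr (-1)) \<le> 1" .
    fix s :: real
    \<comment> \<open>The factor serves both signs of \<open>s\<close>: for \<open>s \<ge> 0\<close>
      the bound \<open>Y \<le> n\<close> suffices, for \<open>s < 0\<close> the bound
      \<open>n \<le> 4 * Y\<close> costs exactly \<open>4 powr s\<close>.\<close>
    have *: "4 powr (- \<bar>s\<bar>) * Y powr s \<le> real n powr s" if n: "n \<in> S" for n
    proof (cases "s \<ge> 0")
      case True
      have "4 powr (- \<bar>s\<bar>) * Y powr s \<le> 1 * Y powr s"
        by (intro mult_right_mono) (auto simp: powr_minus_divide ge_one_powr_ge_zero)
      also have "\<dots> \<le> real n powr s" using S[OF n] Y True by (simp add: powr_mono2)
      finally show ?thesis .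
    next
      case False
      then have "4 powr (- \<bar>s\<bar>) * Y powr s = (4 * Y) powr s" using Y by (simp add: powr_mult)
      also have "\<dots> \<le> real n powr s" using S[OF n] Y False by (intro powr_mono2') auto
      finally show ?thesis .
    qed
    have "4 powr (- \<bar>s\<bar>) * Y powr (s + 1) = Y * (4 powr (- \<bar>s\<bar>) * Y powr s)"
      using Y by (simp add: powr_add)
    also have "\<dots> \<le> real N * (4 powr (- \<bar>s\<bar>) * Y powr s)"
      using N by (intro mult_right_mono) auto
    also have "\<dots> \<le> (\<Sum>n\<in>S. real n powr s)"
      using sum_bounded_below[of S "4 powr (- \<bar>s\<bar>) * Y powr s" "\<lambda>n. real n powr s"] * cardS by simp
    finally show "4 powr (- \<bar>s\<bar>) * Y powr (s + 1) \<le> (\<Sum>n\<in>S. real n powr s)" .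
  qed
qed

text \<open>Passes from series over \<open>Suc n\<close> to finite sums over the actual indices;
  index 0 must lie outside \<open>S\<close>, because the series never reaches it.\<close>

lemma sums_Suc_finite:
  fixes F :: "nat \<Rightarrow> 'a::real_normed_vector"
  assumes "finite S" "0 \<notin> S" "\<And>n. n \<notin> S \<Longrightarrow> F n = 0"
  shows "(\<lambda>n. F (Suc n)) sums sum F S"
proof -
  have "F sums sum F S" using assms by (intro sums_finite) auto
  then show ?thesis using assms by (subst sums_Suc_iff) simp
qed

lemma sum_le_suminf_Suc:
  fixes F :: "nat \<Rightarrow> real"
  assumes "summable (\<lambda>n. F (Suc n))" "finite S" "0 \<notin> S" "\<And>n. 0 \<le> F n"
  shows "sum F S \<le> (\<Sum>n. F (Suc n))"
proof -
  define G where "G n = (if n \<in> S then F n else 0)" for n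
  have "(\<lambda>n. G (Suc n)) sums sum G S" using assms by (intro sums_Suc_finite) (auto simp: G_def)
  moreover have "sum G S = sum F S" by (auto simp: G_def)
  ultimately have GF: "(\<lambda>n. G (Suc n)) sums sum F S" by simp
  have "G (Suc n) \<le> F (Suc n)" for n using assms(4) by (simp add: G_def)
  from sums_le[OF this GF summable_sums[OF assms(1)]] show ?thesis .
qed

section \<open>The operator\<close>

lemma conjugate_exponent_gt_1:
  fixes p q :: real
  assumes "p > 1" "1 / p + 1 / q = 1"
  shows "q > 1"
proof -
  have "1 / q = 1 - 1 / p" using assms(2) by simp
  moreover have "0 < 1 / p" "1 / p < 1" using assms(1) by auto
  ultimately have "0 < 1 / q" "1 / q < 1" by linarith+
  then show ?thesis by (simp add: field_simps split: if_splits)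
qed

text \<open>In the variables \<open>x = m powr \<alpha>\<close> and
  \<open>y = n powr \<beta>\<close> the two power factors become
  \<open>x powr ((1 + \<mu>) / p)\<close> and \<open>y powr (1 - (1 + \<nu>) / p)\<close>, up to
  \<open>m powr (-1/p)\<close> and \<open>n powr (-1/q)\<close>. This form exposes the
  homogeneity.\<close>

lemma H_exponents:
  fixes p q \<alpha> \<beta> \<mu> \<nu> :: real
  assumes "p > 1" "1 / p + 1 / q = 1"
  shows "(1 / p) * ((\<alpha> - 1) + \<alpha> * \<mu>) = \<alpha> * ((1 + \<mu>) / p) - 1 / p"
    and "(1 / q) * ((\<beta> - 1) - (q - 1) * \<beta> * \<nu>) = \<beta> * (1 - (1 + \<nu>) / p) - 1 / q"
proof -
  have q: "q > 1" by (rule conjugate_exponent_gt_1[OF assms])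
  show "(1 / p) * ((\<alpha> - 1) + \<alpha> * \<mu>) = \<alpha> * ((1 + \<mu>) / p) - 1 / p"
    using assms(1) by (simp add: field_simps)
  have 1: "1 / q = 1 - 1 / p" using assms(2) by simp
  have 2: "(q - 1) / q = 1 / p" using 1 q by (simp add: diff_divide_distrib)
  have "(1 / q) * ((\<beta> - 1) - (q - 1) * \<beta> * \<nu>) = (1 / q) * (\<beta> - 1) - ((q - 1) / q) * (\<beta> * \<nu>)"
    using q by (simp add: field_simps)
  also have "\<dots> = \<beta> * (1 - (1 + \<nu>) / p) - 1 / q"
    unfolding 1 2 by (simp add: algebra_simps add_divide_distrib diff_divide_distrib)
  finally show "(1 / q) * ((\<beta> - 1) - (q - 1) * \<beta> * \<nu>) = \<beta> * (1 - (1 + \<nu>) / p) - 1 / q" .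
qed

section \<open>Sufficiency of the condition, by the Schur test\<close>

lemma H_bounded_on_lp_if:
  fixes p q \<alpha> \<beta> \<gamma> \<mu> \<nu> :: real
  assumes p: "p > 1" and pq: "1 / p + 1 / q = 1"
    and ab: "0 < \<alpha>" "\<alpha> \<le> 1" "0 < \<beta>" "\<beta> \<le> 1"
    and mn: "-1 < \<mu>" "\<mu> < p - 1" "-1 < \<nu>" "\<nu> < p - 1"
    and \<gamma>: "1 + (\<mu> - \<nu>) / p \<le> \<gamma>"
  shows "H_bounded_on_lp p q \<mu> \<nu> \<alpha> \<beta> \<gamma>"
proof -
  note q = conjugate_exponent_gt_1[OF p pq]
  define A where "A = (1 / p) * ((\<alpha> - 1) + \<alpha> * \<mu>)"
  define B where "B = (1 / q) * ((\<beta> - 1) - (q - 1) * \<beta> * \<nu>)"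
  define s where "s = (1 + \<mu>) / p"
  define d where "d = 1 - (1 + \<nu>) / p"
  define \<kappa> where "\<kappa> = 1 + (\<mu> - \<nu>) / p"
  \<comment> \<open>The ranges of \<mu> and \<nu> enter here. As \<open>\<kappa> = s + d\<close>,
    the row sums, with exponent \<open>d\<close>, converge because \<open>s > 0\<close>, and the
    column sums, with exponent \<open>s\<close>, because \<open>d > 0\<close>.\<close>
  have sd: "0 < s" "s \<le> 1" "0 < d" "d \<le> 1" using p mn by (auto simp: s_def d_def)
  have \<kappa>: "\<kappa> = s + d" using p by (simp add: \<kappa>_def s_def d_def field_simps)
  have A: "A = \<alpha> * s - 1 / p" and B: "B = \<beta> * d - 1 / q"
    unfolding A_def B_def s_def d_def by (rule H_exponents[OF p pq])+
  have g: "\<kappa> \<le> \<gamma>" using \<gamma> by (simp add: \<kappa>_def)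
  \<comment> \<open>The kernel includes the outer factor of the operator, and both of its indices
    are shifted to start at 0.\<close>
  define K where "K m n = real (Suc m) powr A * (real (Suc n) powr B
      / max (real (Suc m) powr \<alpha>) (real (Suc n) powr \<beta>) powr \<gamma>)" for m n
  \<comment> \<open>One weight serves rows and columns: its \<open>q\<close>-th power turns the
    exponent \<open>B\<close> into \<open>\<beta> * d - 1\<close>, its \<open>p\<close>-th power
    turns \<open>A\<close> into \<open>\<alpha> * s - 1\<close>.\<close>
  define f where "f n = real (Suc n) powr (- (1 / (p * q)))" for n
  have fq: "f n powr q = real (Suc n) powr (- (1 / p))"
    and fp: "f n powr p = real (Suc n) powr (- (1 / q))" for n
    using p q by (simp_all add: f_def powr_powr)
  obtain C where C: "\<And>x N. x \<ge> 1 \<Longrightarrow>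
      (\<Sum>n<N. real (Suc n) powr (\<beta> * d - 1) / max x (real (Suc n) powr \<beta>) powr \<gamma>) \<le> C * x powr (d - \<kappa>)"
    using sum_powr_over_max_upper[of \<beta> d \<kappa> \<gamma>] ab sd g \<kappa> by auto
  obtain D where D: "\<And>x N. x \<ge> 1 \<Longrightarrow>
      (\<Sum>n<N. real (Suc n) powr (\<alpha> * s - 1) / max x (real (Suc n) powr \<alpha>) powr \<gamma>) \<le> D * x powr (s - \<kappa>)"
    using sum_powr_over_max_upper[of \<alpha> s \<kappa> \<gamma>] ab sd g \<kappa> by auto
  have rows: "(\<Sum>n<N. K m n * f n powr q) \<le> C * f m powr q" for m N
  proof -
    have e: "real (Suc n) powr B * real (Suc n) powr (- (1 / p)) = real (Suc n) powr (\<beta> * d - 1)" for n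
    proof -
      have "B + - (1 / p) = \<beta> * d - 1" using pq by (simp add: B)
      then show ?thesis by (metis powr_add)
    qed
    have "(\<Sum>n<N. K m n * f n powr q) = real (Suc m) powr A *
      (\<Sum>n<N. real (Suc n) powr (\<beta> * d - 1) / max (real (Suc m) powr \<alpha>) (real (Suc n) powr \<beta>) powr \<gamma>)"
      unfolding sum_distrib_left
      by (intro sum.cong refl) (simp only: K_def fq e[symmetric] times_divide_eq_left
          times_divide_eq_right mult.assoc)
    also have "\<dots> \<le> real (Suc m) powr A * (C * (real (Suc m) powr \<alpha>) powr (d - \<kappa>))"
      using ab by (intro mult_left_mono C) (auto intro!: ge_one_powr_ge_zero)
    also have "(real (Suc m) powr \<alpha>) powr (d - \<kappa>) = real (Suc m) powr (\<alpha> * (d - \<kappa>))"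
      by (rule powr_powr)
    also have "real (Suc m) powr A * (C * \<dots>) = C * real (Suc m) powr (A + \<alpha> * (d - \<kappa>))"
      by (simp only: powr_add mult_ac)
    \<comment> \<open>Here \<open>d - \<kappa> = - s\<close> cancels the power of \<open>x\<close>
      in the outer factor, so that exactly \<open>f m powr q\<close> remains.\<close>
    also have "A + \<alpha> * (d - \<kappa>) = - (1 / p)" by (simp add: A \<kappa> algebra_simps)
    finally show ?thesis by (simp only: fq)
  qed
  have cols: "(\<Sum>m<M. K m n * f m powr p) \<le> D * f n powr p" for n M
  proof -
    have e: "real (Suc m) powr A * real (Suc m) powr (- (1 / q)) = real (Suc m) powr (\<alpha> * s - 1)" for m
    proof -
      have "A + - (1 / q) = \<alpha> * s - 1" using pq by (simp add: A)
      then show ?thesis by (metis powr_add)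
    qed
    have "(\<Sum>m<M. K m n * f m powr p) = real (Suc n) powr B *
      (\<Sum>m<M. real (Suc m) powr (\<alpha> * s - 1) / max (real (Suc n) powr \<beta>) (real (Suc m) powr \<alpha>) powr \<gamma>)"
      unfolding sum_distrib_left
      by (intro sum.cong refl) (simp only: K_def fp e[symmetric] times_divide_eq_left
          times_divide_eq_right mult_ac max.commute)
    also have "\<dots> \<le> real (Suc n) powr B * (D * (real (Suc n) powr \<beta>) powr (s - \<kappa>))"
      using ab by (intro mult_left_mono D) (auto intro!: ge_one_powr_ge_zero)
    also have "(real (Suc n) powr \<beta>) powr (s - \<kappa>) = real (Suc n) powr (\<beta> * (s - \<kappa>))"
      by (rule powr_powr)
    also have "real (Suc n) powr B * (D * \<dots>) = D * real (Suc n) powr (B + \<beta> * (s - \<kappa>))"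
      by (simp only: powr_add mult_ac)
    also have "B + \<beta> * (s - \<kappa>) = - (1 / q)" by (simp add: B \<kappa> algebra_simps)
    finally show ?thesis by (simp only: fp)
  qed
  define E where "E = C powr (p/q) * D"
  have *: "(\<forall>m\<ge>1. summable (\<lambda>n. H_summand q \<nu> \<alpha> \<beta> \<gamma> a m (Suc n)))
         \<and> H_op p q \<mu> \<nu> \<alpha> \<beta> \<gamma> a \<in> lp p
         \<and> lp_norm p (H_op p q \<mu> \<nu> \<alpha> \<beta> \<gamma> a) \<le> \<bar>E\<bar> powr (1/p) * lp_norm p a" if a: "a \<in> lp p" for a
  proof -
    let ?T = "H_op p q \<mu> \<nu> \<alpha> \<beta> \<gamma> a"
    have sa: "summable (\<lambda>n. norm (a (Suc n)) powr p)" using a by (simp add: lp_def)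
    have K0: "0 \<le> K m n" and f0: "0 < f n" for m n by (simp_all add: K_def f_def)
    \<comment> \<open>The test is applied to the norms of the entries of \<open>a\<close>; the
      triangle inequality then dominates the complex image, and absolute convergence gives the
      required summability.\<close>
    note schur = schur_test[OF p q pq K0 f0 f0 rows cols norm_ge_zero sa]
    have norm_summand: "real (Suc m) powr A * norm (H_summand q \<nu> \<alpha> \<beta> \<gamma> a (Suc m) (Suc n))
        = K m n * norm (a (Suc n))" for m n
      by (simp add: H_summand_def K_def B_def norm_mult norm_divide)
    have sn: "summable (\<lambda>n. norm (H_summand q \<nu> \<alpha> \<beta> \<gamma> a (Suc m) (Suc n)))" for m
    proof -
      have "summable (\<lambda>n. real (Suc m) powr A * norm (H_summand q \<nu> \<alpha> \<beta> \<gamma> a (Suc m) (Suc n)))"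
        using schur(1)[of m] by (simp only: norm_summand)
      then show ?thesis by (simp only: summable_cmult_iff) auto
    qed
    have le: "norm (?T (Suc m)) powr p \<le> (\<Sum>n. K m n * norm (a (Suc n))) powr p" for m
    proof (rule powr_mono2)
      have "norm (?T (Suc m))
          = real (Suc m) powr A * norm (\<Sum>n. H_summand q \<nu> \<alpha> \<beta> \<gamma> a (Suc m) (Suc n))"
        by (simp add: H_op_def A_def norm_mult)
      also have "\<dots> \<le> real (Suc m) powr A * (\<Sum>n. norm (H_summand q \<nu> \<alpha> \<beta> \<gamma> a (Suc m) (Suc n)))"
        by (intro mult_left_mono summable_norm sn) auto
      also have "\<dots> = (\<Sum>n. K m n * norm (a (Suc n)))"
        by (subst suminf_mult[symmetric]) (simp_all only: sn norm_summand)
      finally show "norm (?T (Suc m)) \<le> (\<Sum>n. K m n * norm (a (Suc n)))" .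
    qed (use p in auto)
    have sT: "summable (\<lambda>m. norm (?T (Suc m)) powr p)"
      by (rule summable_comparison_test'[OF schur(2), of 0]) (use le in simp)
    have "(\<Sum>m. norm (?T (Suc m)) powr p) \<le> (\<Sum>m. (\<Sum>n. K m n * norm (a (Suc n))) powr p)"
      by (intro suminf_le le sT schur(2))
    also have "\<dots> \<le> E * (\<Sum>n. norm (a (Suc n)) powr p)"
      using schur(3) by (simp add: E_def)
    also have "\<dots> \<le> \<bar>E\<bar> * (\<Sum>n. norm (a (Suc n)) powr p)"
      using sa by (intro mult_right_mono suminf_nonneg) auto
    finally have "(\<Sum>m. norm (?T (Suc m)) powr p) powr (1/p)
        \<le> (\<bar>E\<bar> * (\<Sum>n. norm (a (Suc n)) powr p)) powr (1/p)"
      using p sT by (intro powr_mono2 suminf_nonneg) auto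
    also have "\<dots> = \<bar>E\<bar> powr (1/p) * lp_norm p a"
      using suminf_nonneg[OF sa] by (simp add: powr_mult lp_norm_def)
    finally have "lp_norm p ?T \<le> \<bar>E\<bar> powr (1/p) * lp_norm p a" by (simp add: lp_norm_def)
    moreover have "summable (\<lambda>n. H_summand q \<nu> \<alpha> \<beta> \<gamma> a m (Suc n))" if "m \<ge> 1" for m
      using summable_norm_cancel[OF sn, of "m - 1"] that by simp
    ultimately show ?thesis using sT by (simp add: lp_def)
  qed
  show ?thesis unfolding H_bounded_on_lp_def
    by (intro conjI exI[of _ "\<bar>E\<bar> powr (1/p)"] ballI) (use * in blast)+
qed

section \<open>Necessity of the condition, by testing on blocks\<close>

lemma H_bounded_on_lp_imp:
  fixes p q \<alpha> \<beta> \<gamma> \<mu> \<nu> :: real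
  assumes p: "p > 1" and pq: "1 / p + 1 / q = 1" and \<gamma>: "\<gamma> > 0"
    and ab: "0 < \<alpha>" "\<alpha> \<le> 1" "0 < \<beta>" "\<beta> \<le> 1"
    and bounded: "H_bounded_on_lp p q \<mu> \<nu> \<alpha> \<beta> \<gamma>"
  shows "1 + (\<mu> - \<nu>) / p \<le> \<gamma>"
proof (rule ccontr)
  assume "\<not> ?thesis"
  then have lt: "\<gamma> < 1 + (\<mu> - \<nu>) / p" by simp
  note q = conjugate_exponent_gt_1[OF p pq]
  define A where "A = (1 / p) * ((\<alpha> - 1) + \<alpha> * \<mu>)"
  define B where "B = (1 / q) * ((\<beta> - 1) - (q - 1) * \<beta> * \<nu>)"
  define s where "s = (1 + \<mu>) / p"
  define d where "d = 1 - (1 + \<nu>) / p"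
  define \<epsilon> where "\<epsilon> = s + d - \<gamma>"
  have \<epsilon>: "\<epsilon> > 0" using lt by (simp add: \<epsilon>_def s_def d_def add_divide_distrib diff_divide_distrib)
  have A: "A = \<alpha> * s - 1 / p" and B: "B = \<beta> * d - 1 / q"
    unfolding A_def B_def s_def d_def by (rule H_exponents[OF p pq])+
  obtain C where C: "\<And>a. a \<in> lp p \<Longrightarrow>
      H_op p q \<mu> \<nu> \<alpha> \<beta> \<gamma> a \<in> lp p \<and> lp_norm p (H_op p q \<mu> \<nu> \<alpha> \<beta> \<gamma> a) \<le> C * lp_norm p a"
    using bounded unfolding H_bounded_on_lp_def by blast
  \<comment> \<open>The first factor of \<open>c\<close> comes from the maximum being at most
    \<open>4 * R\<close> on the blocks, the second from the block sum over \<open>n\<close>. In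
    \<open>c'\<close> the additional factor comes from the block sum over \<open>m\<close>.\<close>
  define c where "c = 4 powr (- \<gamma>) * 4 powr (- \<bar>\<beta> * d - 1\<bar>)"
  define c' where "c' = c powr p * 4 powr (- \<bar>A * p\<bar>)"
  have c: "c > 0" "c' > 0" by (simp_all add: c_def c'_def)
  \<comment> \<open>The left side is unbounded in \<open>R\<close> while the right side is fixed,
    which is the contradiction sought.\<close>
  have key: "c' * R powr (p * \<epsilon>) \<le> \<bar>C\<bar> powr p" if R: "R \<ge> 1" for R
  proof -
    define Y where "Y = R powr (1/\<beta>)"
    define Z where "Z = R powr (1/\<alpha>)"
    have YZ: "Y \<ge> 1" "Z \<ge> 1" unfolding Y_def Z_def using R ab by (auto intro!: ge_one_powr_ge_zero)
    have Ypow: "Y powr (\<beta> * t) = R powr t" and Zpow: "Z powr (\<alpha> * t) = R powr t" for t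
      using ab by (simp_all add: Y_def Z_def powr_powr)
    obtain S where S: "finite S" "0 \<notin> S" "\<And>n. n \<in> S \<Longrightarrow> Y \<le> real n \<and> real n \<le> 4 * Y"
      "(\<Sum>n\<in>S. real n powr (-1)) \<le> 1"
      "\<And>t. 4 powr (- \<bar>t\<bar>) * Y powr (t + 1) \<le> (\<Sum>n\<in>S. real n powr t)"
      using dyadic_block[OF YZ(1)] by metis
    obtain T where T: "finite T" "0 \<notin> T" "\<And>m. m \<in> T \<Longrightarrow> Z \<le> real m \<and> real m \<le> 4 * Z"
      "\<And>t. 4 powr (- \<bar>t\<bar>) * Z powr (t + 1) \<le> (\<Sum>m\<in>T. real m powr t)"
      using dyadic_block[OF YZ(2)] by metis
    \<comment> \<open>Used with \<open>t\<close> equal to \<alpha> and \<beta>: since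
      \<open>t \<le> 1\<close>, the factor 4 between the ends of a block stays at most 4 after
      raising to the power \<open>t\<close>.\<close>
    have small: "real n powr t \<le> 4 * R"
      if "real n \<le> 4 * X" "X = R powr (1/t)" "0 < t" "t \<le> 1" for n X t
    proof -
      have "real n powr t \<le> (4 * X) powr t" using that by (intro powr_mono2) auto
      also have "\<dots> = 4 powr t * R" using that R by (simp add: powr_mult powr_powr)
      also have "\<dots> \<le> 4 powr 1 * R" using that R by (intro mult_right_mono powr_mono) auto
      finally show ?thesis by simp
    qed
    \<comment> \<open>The finite support reduces each series defining the image to a finite sum, and
      the \<open>p\<close>-th powers of the entries add up to the block sum of
      \<open>n powr (-1)\<close>, hence to at most 1.\<close>
    define a :: "nat \<Rightarrow> complex"
      where "a n = (if n \<in> S then complex_of_real (real n powr (- (1 / p))) else 0)" for n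
    let ?T = "H_op p q \<mu> \<nu> \<alpha> \<beta> \<gamma> a"
    have "(\<lambda>n. norm (a (Suc n)) powr p) sums (\<Sum>n\<in>S. norm (a n) powr p)"
      using sums_Suc_finite[of S "\<lambda>n. norm (a n) powr p"] S(1,2) by (simp add: a_def)
    moreover have "(\<Sum>n\<in>S. norm (a n) powr p) = (\<Sum>n\<in>S. real n powr (-1))"
      using p by (intro sum.cong refl) (simp add: a_def powr_powr)
    ultimately have as: "(\<lambda>n. norm (a (Suc n)) powr p) sums (\<Sum>n\<in>S. real n powr (-1))" by simp
    then have alp: "a \<in> lp p" by (simp add: lp_def sums_iff)
    have "lp_norm p a = (\<Sum>n\<in>S. real n powr (-1)) powr (1/p)"
      using as by (simp add: lp_norm_def sums_iff)
    also have "\<dots> \<le> 1" using p S(4) by (intro powr_le1) (auto simp: sum_nonneg)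
    finally have na: "lp_norm p a \<le> 1" .
    have Tlp: "summable (\<lambda>m. norm (?T (Suc m)) powr p)" using C[OF alp] by (simp add: lp_def)
    have "lp_norm p ?T \<le> C * lp_norm p a" using C[OF alp] by blast
    also have "\<dots> \<le> \<bar>C\<bar> * 1" using na by (intro mult_mono) (auto simp: lp_norm_def)
    finally have "(\<Sum>m. norm (?T (Suc m)) powr p) powr (1/p) \<le> \<bar>C\<bar>" by (simp add: lp_norm_def)
    then have "((\<Sum>m. norm (?T (Suc m)) powr p) powr (1/p)) powr p \<le> \<bar>C\<bar> powr p"
      using p by (intro powr_mono2) auto
    then have upper: "(\<Sum>m. norm (?T (Suc m)) powr p) \<le> \<bar>C\<bar> powr p"
      using p suminf_nonneg[OF Tlp] by (simp add: powr_powr)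
    have lower: "(c * R powr (d - \<gamma>) * real m powr A) powr p \<le> norm (?T m) powr p" if m: "m \<in> T" for m
    proof (rule powr_mono2)
      let ?W = "\<Sum>n\<in>S. real n powr (\<beta> * d - 1) / max (real m powr \<alpha>) (real n powr \<beta>) powr \<gamma>"
      have m0: "real m > 0" using T(2) m by (cases m) auto
      have "(\<lambda>n. H_summand q \<nu> \<alpha> \<beta> \<gamma> a m (Suc n)) sums (\<Sum>n\<in>S. H_summand q \<nu> \<alpha> \<beta> \<gamma> a m n)"
        using S(1,2) by (intro sums_Suc_finite) (auto simp: H_summand_def a_def)
      then have "(\<Sum>n. H_summand q \<nu> \<alpha> \<beta> \<gamma> a m (Suc n)) = (\<Sum>n\<in>S. H_summand q \<nu> \<alpha> \<beta> \<gamma> a m n)"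
        by (rule sums_unique[symmetric])
      also have "\<dots> = complex_of_real ?W"
        unfolding of_real_sum
      proof (intro sum.cong refl)
        fix n assume n: "n \<in> S"
        have "B + - (1 / p) = \<beta> * d - 1" using pq by (simp add: B)
        then have "real n powr B * real n powr (- (1 / p)) = real n powr (\<beta> * d - 1)"
          by (metis powr_add)
        then show "H_summand q \<nu> \<alpha> \<beta> \<gamma> a m n = complex_of_real
            (real n powr (\<beta> * d - 1) / max (real m powr \<alpha>) (real n powr \<beta>) powr \<gamma>)"
          unfolding H_summand_def B_def[symmetric] a_def using n
          by (simp only: if_True of_real_mult[symmetric] times_divide_eq_left)
      qed
      \<comment> \<open>All terms are nonnegative reals, so no cancellation occurs and the norm is
        the sum itself.\<close>
      finally have "norm (?T m) = real m powr A * ?W"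
        by (simp add: H_op_def A_def norm_mult sum_nonneg del: of_real_sum of_real_divide)
      moreover have "c * R powr (d - \<gamma>) \<le> ?W"
      proof -
        have "c * R powr (d - \<gamma>) = (4 powr (- \<bar>\<beta> * d - 1\<bar>) * Y powr (\<beta> * d - 1 + 1)) * (4 * R) powr (- \<gamma>)"
          using R Ypow[of d] powr_add[of R d "- \<gamma>"] by (simp add: c_def powr_mult)
        also have "\<dots> \<le> (\<Sum>n\<in>S. real n powr (\<beta> * d - 1)) * (4 * R) powr (- \<gamma>)"
          by (intro mult_right_mono S(5)) auto
        also have "\<dots> \<le> ?W"
          unfolding sum_distrib_right
        proof (rule sum_mono)
          fix n assume n: "n \<in> S"
          have n0: "real n > 0" using S(2) n by (cases n) auto
          have "max (real m powr \<alpha>) (real n powr \<beta>) \<le> 4 * R"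
            using small[OF _ Z_def, of m] small[OF _ Y_def, of n] S(3)[OF n] T(3)[OF m] ab by auto
          then have "max (real m powr \<alpha>) (real n powr \<beta>) powr \<gamma> \<le> (4 * R) powr \<gamma>"
            using \<gamma> by (intro powr_mono2) (auto simp: le_max_iff_disj)
          then have "real n powr (\<beta> * d - 1) / (4 * R) powr \<gamma>
              \<le> real n powr (\<beta> * d - 1) / max (real m powr \<alpha>) (real n powr \<beta>) powr \<gamma>"
            using m0 n0 R by (intro divide_left_mono mult_pos_pos) (auto simp: max_def)
          then show "real n powr (\<beta> * d - 1) * (4 * R) powr (- \<gamma>)
              \<le> real n powr (\<beta> * d - 1) / max (real m powr \<alpha>) (real n powr \<beta>) powr \<gamma>"
            by (simp add: powr_minus_divide)
        qed
        finally show ?thesis .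
      qed
      ultimately show "c * R powr (d - \<gamma>) * real m powr A \<le> norm (?T m)"
        by (simp add: mult.commute mult_left_mono)
    qed (use p c in auto)
    \<comment> \<open>Summing over \<open>m\<close> contributes
      \<open>Z powr (A * p + 1) = R powr (s * p)\<close>; together with
      \<open>R powr ((d - \<gamma>) * p)\<close> from each row this gives
      \<open>R powr (p * \<epsilon>)\<close>.\<close>
    have "c' * R powr (p * \<epsilon>)
        = (c * R powr (d - \<gamma>)) powr p * (4 powr (- \<bar>A * p\<bar>) * Z powr (A * p + 1))"
    proof -
      have "A * p + 1 = \<alpha> * (s * p)" using p by (simp add: A algebra_simps)
      then have "Z powr (A * p + 1) = R powr (s * p)" by (simp only: Zpow)
      moreover have "R powr (p * \<epsilon>) = R powr ((d - \<gamma>) * p) * R powr (s * p)"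
      proof -
        have "p * \<epsilon> = (d - \<gamma>) * p + s * p" by (simp add: \<epsilon>_def algebra_simps)
        then show ?thesis by (simp only: powr_add)
      qed
      ultimately show ?thesis using c by (simp add: c'_def powr_mult powr_powr)
    qed
    also have "\<dots> \<le> (c * R powr (d - \<gamma>)) powr p * (\<Sum>m\<in>T. real m powr (A * p))"
      by (intro mult_left_mono T(4)) auto
    also have "\<dots> = (\<Sum>m\<in>T. (c * R powr (d - \<gamma>) * real m powr A) powr p)"
      unfolding sum_distrib_left using c by (intro sum.cong refl) (simp add: powr_mult powr_powr)
    also have "\<dots> \<le> (\<Sum>m\<in>T. norm (?T m) powr p)" by (intro sum_mono lower)
    also have "\<dots> \<le> (\<Sum>m. norm (?T (Suc m)) powr p)"
      using Tlp T(1,2) by (intro sum_le_suminf_Suc) auto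
    finally show ?thesis using upper by linarith
  qed
  \<comment> \<open>Chosen so that the left side of \<open>key\<close> equals
    \<open>\<bar>C\<bar> powr p + c'\<close>; the summand 1 also ensures
    \<open>R \<ge> 1\<close>.\<close>
  define R where "R = (\<bar>C\<bar> powr p / c' + 1) powr (1 / (p * \<epsilon>))"
  have "R \<ge> 1" unfolding R_def using p \<epsilon> c by (intro ge_one_powr_ge_zero) auto
  moreover have "R powr (p * \<epsilon>) = \<bar>C\<bar> powr p / c' + 1"
    unfolding R_def using p \<epsilon> c by (simp add: powr_powr add_nonneg_nonneg)
  ultimately have "c' * (\<bar>C\<bar> powr p / c' + 1) \<le> \<bar>C\<bar> powr p" using key by metis
  then show False using c by (simp add: distrib_left)
qed

theorem theorem1p2:
  fixes p p' \<alpha> \<beta> \<gamma> \<mu> \<nu> :: real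
  assumes "p > 1" and "1 / p + 1 / p' = 1"
    and "\<gamma> > 0"
    and "0 < \<alpha>" "\<alpha> \<le> 1" and "0 < \<beta>" "\<beta> \<le> 1"
    and "-1 < \<mu>" "\<mu> < p - 1" and "-1 < \<nu>" "\<nu> < p - 1"
  shows "H_bounded_on_lp p p' \<mu> \<nu> \<alpha> \<beta> \<gamma> \<longleftrightarrow> p * (\<gamma> - 1) - (\<mu> - \<nu>) \<ge> 0"
proof -
  have "p * (\<gamma> - 1) - (\<mu> - \<nu>) \<ge> 0 \<longleftrightarrow> 1 + (\<mu> - \<nu>) / p \<le> \<gamma>"
    using assms(1) by (simp add: field_simps)
  then show ?thesis
    using H_bounded_on_lp_if[OF assms(1,2,4-11)] H_bounded_on_lp_imp[OF assms(1-7)] by blast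
qed

end
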